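(* Let $\Phi$ be a finite irreducible crystallographic root system with simple system $\Pi$, let $S\subseteq\Pi$ and $\beta\in\Phi^+$ with $S\cap\mathrm{Supp}(\beta)\ne\emptyset$. (1) The set $\Phi_{S,\beta}$ contains only short roots if and only if $\min\Phi_{S,\beta}$ is short. (2) The set $\Phi_{S,\beta}$ contains only long roots if and only if $\min\Phi_{S,\beta}$ is long and the connected component of $\min\Phi_{S,\beta}$ in the Dynkin diagram of $(\Pi\setminus S)\cup\{\min\Phi_{S,\beta}\}$ contains only long simple roots. (3) The set $\Phi_{S,\beta}$ contains both long and short roots if and only if $\min\Phi_{S,\beta}$ is long and the connected component of $\min\Phi_{S,\beta}$ in the Dynkin diagram of $(\Pi\setminus S)\cup\{\min\Phi_{S,\beta}\}$ contains some short simple root.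
   Context: $\Phi$ is reduced, in a Euclidean space with Weyl-group-invariant form; $\Phi^+$ is the set of positive roots with respect to $\Pi$. Each root $\gamma$ is written $\gamma=\sum_{\alpha\in\Pi}c_\alpha(\gamma)\alpha$; $\mathrm{Supp}(\gamma)=\{\alpha\in\Pi:c_\alpha(\gamma)\ne0\}$. Define $\Phi_{S,\beta}=\{\gamma\in\Phi:c_\alpha(\gamma)=c_\alpha(\beta)\ \forall\alpha\in S\}$ and $\Phi_{S,\mathbb Z\beta}=\{\gamma\in\Phi:\exists k\in\mathbb Z\text{ with }c_\alpha(\gamma)=k\,c_\alpha(\beta)\ \forall\alpha\in S\}$. When $\beta\in\Phi^+$ and $\mathrm{Supp}(\beta)\cap S\ne\emptyset$, $\Phi_{S,\beta}$ has a minimum in the root poset ($\Phi^+$ ordered by $\alpha\le\beta$ iff $\beta-\alpha$ is a nonnegative linear combination of positive roots), and $(\Pi\setminus S)\cup\{\min\Phi_{S,\beta}\}$ is a simple system of the root subsystem $\Phi_{S,\mathbb Z\beta}$; "simple roots" in (2), (3) refers to this simple system. Long and short are meant relative to $\Phi$; in simply laced $\Phi$ all roots are considered long. *)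

theory Defs
  imports "HOL-Analysis.Analysis"
begin

definition cartan :: "'a::euclidean_space \<Rightarrow> 'a \<Rightarrow> real" where
  "cartan \<gamma> \<alpha> = 2 * (\<gamma> \<bullet> \<alpha>) / (\<alpha> \<bullet> \<alpha>)"

definition reflection :: "'a::euclidean_space \<Rightarrow> 'a \<Rightarrow> 'a" where
  "reflection \<alpha> x = x - cartan x \<alpha> *\<^sub>R \<alpha>"

text \<open>Finite, reduced and crystallographic. The reflections are those of the ambient inner
  product, which is therefore invariant under the Weyl group.\<close>

definition root_system :: "'a::euclidean_space set \<Rightarrow> bool" where
  "root_system \<Phi> \<longleftrightarrow>
     finite \<Phi> \<and> 0 \<notin> \<Phi> \<and> span \<Phi> = UNIV \<and>
     (\<forall>\<alpha>\<in>\<Phi>. reflection \<alpha> ` \<Phi> = \<Phi>) \<and>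
     (\<forall>\<alpha>\<in>\<Phi>. \<forall>\<gamma>\<in>\<Phi>. cartan \<gamma> \<alpha> \<in> \<int>) \<and>
     (\<forall>\<alpha>\<in>\<Phi>. \<forall>c. c *\<^sub>R \<alpha> \<in> \<Phi> \<longrightarrow> c = 1 \<or> c = -1)"

definition irreducible_root_system :: "'a::euclidean_space set \<Rightarrow> bool" where
  "irreducible_root_system \<Phi> \<longleftrightarrow>
     root_system \<Phi> \<and> \<Phi> \<noteq> {} \<and>
     \<not> (\<exists>A B. A \<noteq> {} \<and> B \<noteq> {} \<and> A \<inter> B = {} \<and> A \<union> B = \<Phi> \<and> (\<forall>x\<in>A. \<forall>y\<in>B. x \<bullet> y = 0))"

text \<open>Simple systems are written \<open>\<Delta>\<close>, because \<open>\<Pi>\<close> is reserved for dependent products.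
  Here and below, the coefficient of \<open>\<alpha>\<close> in the expansion of \<open>\<gamma>\<close> in the basis \<open>\<Delta>\<close> is
  \<open>representation \<Delta> \<gamma> \<alpha>\<close>. As \<open>representation\<close> is constantly 0 outside of the span of \<open>\<Delta>\<close>,
  the inclusion of \<open>\<Phi>\<close> in this span has to be required explicitly.\<close>

definition simple_system :: "'a::euclidean_space set \<Rightarrow> 'a set \<Rightarrow> bool" where
  "simple_system \<Phi> \<Delta> \<longleftrightarrow>
     \<Delta> \<subseteq> \<Phi> \<and> independent \<Delta> \<and> \<Phi> \<subseteq> span \<Delta> \<and>
     (\<forall>\<gamma>\<in>\<Phi>. (\<forall>\<alpha>\<in>\<Delta>. representation \<Delta> \<gamma> \<alpha> \<in> \<int>) \<and>
        ((\<forall>\<alpha>\<in>\<Delta>. representation \<Delta> \<gamma> \<alpha> \<ge> 0) \<or> (\<forall>\<alpha>\<in>\<Delta>. representation \<Delta> \<gamma> \<alpha> \<le> 0)))"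

definition positive_roots :: "'a::euclidean_space set \<Rightarrow> 'a set \<Rightarrow> 'a set" where
  "positive_roots \<Phi> \<Delta> = {\<gamma>\<in>\<Phi>. \<forall>\<alpha>\<in>\<Delta>. representation \<Delta> \<gamma> \<alpha> \<ge> 0}"

definition Supp :: "'a::euclidean_space set \<Rightarrow> 'a \<Rightarrow> 'a set" where
  "Supp \<Delta> \<gamma> = {\<alpha>\<in>\<Delta>. representation \<Delta> \<gamma> \<alpha> \<noteq> 0}"

definition root_le :: "'a::euclidean_space set \<Rightarrow> 'a set \<Rightarrow> 'a \<Rightarrow> 'a \<Rightarrow> bool" where
  "root_le \<Phi> \<Delta> \<gamma> \<delta> \<longleftrightarrow>
     (\<exists>f. (\<forall>\<epsilon>\<in>positive_roots \<Phi> \<Delta>. f \<epsilon> \<ge> (0::real)) \<and>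
          \<delta> - \<gamma> = (\<Sum>\<epsilon>\<in>positive_roots \<Phi> \<Delta>. f \<epsilon> *\<^sub>R \<epsilon>))"

text \<open>The set \<open>\<Phi>\<^bsub>S,\<beta>\<^esub>\<close>.\<close>

definition level_roots :: "'a::euclidean_space set \<Rightarrow> 'a set \<Rightarrow> 'a set \<Rightarrow> 'a \<Rightarrow> 'a set" where
  "level_roots \<Phi> \<Delta> S \<beta> =
     {\<gamma>\<in>\<Phi>. \<forall>\<alpha>\<in>S. representation \<Delta> \<gamma> \<alpha> = representation \<Delta> \<beta> \<alpha>}"

text \<open>The least element (not merely a minimal one) of \<open>\<Phi>\<^bsub>S,\<beta>\<^esub>\<close>. It exists if \<open>\<beta>\<close> is a positive root
  whose support meets \<open>S\<close>; otherwise the value is meaningless.\<close>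

definition min_level_root :: "'a::euclidean_space set \<Rightarrow> 'a set \<Rightarrow> 'a set \<Rightarrow> 'a \<Rightarrow> 'a" where
  "min_level_root \<Phi> \<Delta> S \<beta> =
     (THE m. m \<in> level_roots \<Phi> \<Delta> S \<beta> \<and> (\<forall>\<gamma>\<in>level_roots \<Phi> \<Delta> S \<beta>. root_le \<Phi> \<Delta> m \<gamma>))"

text \<open>An irreducible root system has at most two root lengths. If there is only one, every root is
  long and none is short.\<close>

definition long_root :: "'a::euclidean_space set \<Rightarrow> 'a \<Rightarrow> bool" where
  "long_root \<Phi> \<gamma> \<longleftrightarrow> \<gamma> \<in> \<Phi> \<and> (\<forall>\<delta>\<in>\<Phi>. norm \<delta> \<le> norm \<gamma>)"

definition short_root :: "'a::euclidean_space set \<Rightarrow> 'a \<Rightarrow> bool" where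
  "short_root \<Phi> \<gamma> \<longleftrightarrow> \<gamma> \<in> \<Phi> \<and> (\<forall>\<delta>\<in>\<Phi>. norm \<gamma> \<le> norm \<delta>) \<and> \<not> long_root \<Phi> \<gamma>"

text \<open>In the Dynkin diagram of a set \<open>D\<close> of simple roots, distinct vertices \<open>x\<close> and \<open>y\<close> are joined by
  \<open>cartan x y * cartan y x\<close> bonds; only whether this number is nonzero matters for connectedness.\<close>

definition dynkin_edges :: "'a::euclidean_space set \<Rightarrow> ('a \<times> 'a) set" where
  "dynkin_edges D = {(x, y). x \<in> D \<and> y \<in> D \<and> x \<noteq> y \<and> cartan x y * cartan y x \<noteq> 0}"

definition dynkin_component :: "'a::euclidean_space set \<Rightarrow> 'a \<Rightarrow> 'a set" where
  "dynkin_component D v = {w\<in>D. (v, w) \<in> (dynkin_edges D)\<^sup>*}"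

end

theory Submission
  imports Defs
begin

text \<open>Write \<open>L\<close> for the level set, \<open>J = \<Delta> - S\<close> and \<open>m\<close> for the minimum. The reflections in \<open>J\<close> preserve
  \<open>L\<close>, so every root of \<open>L\<close> has the length of some \<open>J\<close>-antidominant root of \<open>L\<close>. Two \<open>J\<close>-antidominant
  roots of \<open>L\<close> have positive inner product, hence differ by a root or are equal; this gives the existence
  of \<open>m\<close>. If \<open>\<gamma> \<noteq> m\<close> is antidominant in \<open>L\<close>, then \<open>\<rho> = \<gamma> - m\<close> is a root with \<open>\<gamma> \<bullet> \<rho> \<le> 0\<close>, so both \<open>\<gamma>\<close> and
  \<open>\<rho>\<close> are strictly shorter than \<open>m\<close>, and \<open>\<rho>\<close> has a short simple root in its support, which lies in
  the component of \<open>m\<close>. Conversely, a short simple root in the component of a long \<open>m\<close> yields a long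
  \<open>\<delta> \<in> L\<close> and a short \<open>\<alpha> \<in> J\<close> with \<open>\<delta> \<bullet> \<alpha> < 0\<close>, and then \<open>\<delta> + \<alpha> \<in> L\<close> is short.\<close>

section \<open>Reflections and Cartan numbers\<close>

lemma inner_reflection_self:
  fixes \<alpha> x :: "'a::euclidean_space"
  assumes "\<alpha> \<noteq> 0"
  shows "reflection \<alpha> x \<bullet> reflection \<alpha> x = x \<bullet> x"
  using assms by (simp add: reflection_def cartan_def inner_diff inner_commute field_simps)

lemma norm_reflection:
  fixes \<alpha> x :: "'a::euclidean_space"
  assumes "\<alpha> \<noteq> 0"
  shows "norm (reflection \<alpha> x) = norm x"
  using inner_reflection_self[OF assms] by (simp add: norm_eq_sqrt_inner)

lemma cartan_pos_iff:
  fixes \<alpha> x :: "'a::euclidean_space"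
  assumes "\<alpha> \<noteq> 0"
  shows "cartan x \<alpha> > 0 \<longleftrightarrow> x \<bullet> \<alpha> > 0"
proof -
  have "\<alpha> \<bullet> \<alpha> > 0" using assms by simp
  then show ?thesis unfolding cartan_def pos_less_divide_eq[OF \<open>\<alpha> \<bullet> \<alpha> > 0\<close>] by simp
qed

lemma cartan_eq_0_iff:
  fixes \<alpha> x :: "'a::euclidean_space"
  assumes "\<alpha> \<noteq> 0"
  shows "cartan x \<alpha> = 0 \<longleftrightarrow> x \<bullet> \<alpha> = 0"
  using assms by (simp add: cartan_def)

lemma reflection_inner_self:
  fixes \<alpha> x :: "'a::euclidean_space"
  assumes "\<alpha> \<noteq> 0"
  shows "reflection \<alpha> x \<bullet> \<alpha> = - (x \<bullet> \<alpha>)"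
  using assms by (simp add: reflection_def cartan_def inner_diff)

lemma finite_minimizer:
  fixes f :: "'b \<Rightarrow> real"
  assumes "finite T" "T \<noteq> {}"
  obtains x where "x \<in> T" "\<And>y. y \<in> T \<Longrightarrow> f x \<le> f y"
  using ex_is_arg_min_if_finite[OF assms, of f] by (auto simp: is_arg_min_linorder)

section \<open>Root systems: sums, differences and lengths of roots\<close>

locale root_sys =
  fixes \<Phi> :: "'a::euclidean_space set"
  assumes root_system: "root_system \<Phi>"
begin

lemma finite_roots: "finite \<Phi>"
  using root_system by (simp add: root_system_def)

lemma root_nonzero: "\<alpha> \<in> \<Phi> \<Longrightarrow> \<alpha> \<noteq> 0"
  using root_system by (auto simp: root_system_def)

lemma reflection_root: "\<alpha> \<in> \<Phi> \<Longrightarrow> x \<in> \<Phi> \<Longrightarrow> reflection \<alpha> x \<in> \<Phi>"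
  using root_system by (auto simp: root_system_def)

lemma cartan_Ints: "\<alpha> \<in> \<Phi> \<Longrightarrow> x \<in> \<Phi> \<Longrightarrow> cartan x \<alpha> \<in> \<int>"
  using root_system by (auto simp: root_system_def)

lemma root_multiple: "\<alpha> \<in> \<Phi> \<Longrightarrow> c *\<^sub>R \<alpha> \<in> \<Phi> \<Longrightarrow> c = 1 \<or> c = -1"
  using root_system by (auto simp: root_system_def)

lemma uminus_root:
  assumes "\<alpha> \<in> \<Phi>" shows "- \<alpha> \<in> \<Phi>"
proof -
  have "reflection \<alpha> \<alpha> = - \<alpha>"
    using root_nonzero[OF assms] by (simp add: reflection_def cartan_def scaleR_2)
  with reflection_root[OF assms assms] show ?thesis by simp
qed

text \<open>Strict Cauchy-Schwarz: as \<Phi> is reduced, \<gamma> is not a multiple of \<alpha>, so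
  \<gamma> minus its projection to the line of \<alpha> has positive square length.\<close>

lemma cartan_mult_less_4:
  assumes "\<alpha> \<in> \<Phi>" "\<gamma> \<in> \<Phi>" "\<gamma> \<noteq> \<alpha>" "\<gamma> \<noteq> - \<alpha>"
  shows "cartan \<gamma> \<alpha> * cartan \<alpha> \<gamma> < 4"
proof -
  have nz: "\<alpha> \<bullet> \<alpha> > 0" "\<gamma> \<bullet> \<gamma> > 0"
    using root_nonzero assms by auto
  define t where "t = (\<gamma> \<bullet> \<alpha>) / (\<alpha> \<bullet> \<alpha>)"
  have "\<gamma> - t *\<^sub>R \<alpha> \<noteq> 0"
    using root_multiple[OF assms(1), of t] assms by auto
  then have "(\<gamma> - t *\<^sub>R \<alpha>) \<bullet> (\<gamma> - t *\<^sub>R \<alpha>) > 0" by simp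
  moreover have "(\<gamma> - t *\<^sub>R \<alpha>) \<bullet> (\<gamma> - t *\<^sub>R \<alpha>) = \<gamma> \<bullet> \<gamma> - (\<gamma> \<bullet> \<alpha>)\<^sup>2 / (\<alpha> \<bullet> \<alpha>)"
    using nz by (simp add: t_def inner_diff inner_commute power2_eq_square)
  ultimately have "(\<gamma> \<bullet> \<alpha>)\<^sup>2 < (\<gamma> \<bullet> \<gamma>) * (\<alpha> \<bullet> \<alpha>)"
    using nz by (simp add: field_simps)
  moreover have "cartan \<gamma> \<alpha> * cartan \<alpha> \<gamma> = 4 * (\<gamma> \<bullet> \<alpha>)\<^sup>2 / ((\<gamma> \<bullet> \<gamma>) * (\<alpha> \<bullet> \<alpha>))"
    by (simp add: cartan_def inner_commute power2_eq_square)
  ultimately show ?thesis using nz by (simp add: divide_less_eq)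
qed

text \<open>Both Cartan numbers are positive integers with product below 4, so one of them is 1. The
  corresponding reflection yields the difference up to sign.\<close>

lemma diff_root:
  assumes "\<alpha> \<in> \<Phi>" "\<gamma> \<in> \<Phi>" "\<gamma> \<noteq> \<alpha>" "\<gamma> \<bullet> \<alpha> > 0"
  shows "\<gamma> - \<alpha> \<in> \<Phi>"
proof -
  have nz: "\<alpha> \<noteq> 0" "\<gamma> \<noteq> 0" using root_nonzero assms by auto
  have "\<gamma> \<noteq> - \<alpha>" using assms(4) nz
    by (metis inner_gt_zero_iff inner_minus_left neg_0_less_iff_less not_less_iff_gr_or_eq)
  then have lt: "cartan \<gamma> \<alpha> * cartan \<alpha> \<gamma> < 4" using cartan_mult_less_4 assms by blast
  obtain i j where ij: "cartan \<gamma> \<alpha> = real_of_int i" "cartan \<alpha> \<gamma> = real_of_int j"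
    using cartan_Ints assms by (meson Ints_cases)
  have "i > 0" "j > 0"
    using cartan_pos_iff nz assms(4) ij by (metis inner_commute of_int_0_less_iff)+
  moreover have "i * j < 4" using lt ij by (metis of_int_less_iff of_int_mult of_int_numeral)
  moreover have "2 * 2 \<le> i * j" if "i \<ge> 2" "j \<ge> 2"
    using that by (intro mult_mono) auto
  ultimately have "i = 1 \<or> j = 1" by linarith
  then show ?thesis
  proof
    assume "i = 1"
    then show ?thesis using reflection_root[OF assms(1,2)] ij by (simp add: reflection_def)
  next
    assume "j = 1"
    then have "\<alpha> - \<gamma> \<in> \<Phi>" using reflection_root[OF assms(2,1)] ij by (simp add: reflection_def)
    then show ?thesis using uminus_root by fastforce
  qed
qed

lemma add_root:
  assumes "\<alpha> \<in> \<Phi>" "\<gamma> \<in> \<Phi>" "\<gamma> \<noteq> - \<alpha>" "\<gamma> \<bullet> \<alpha> < 0"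
  shows "\<gamma> + \<alpha> \<in> \<Phi>"
  using diff_root[of "- \<alpha>" \<gamma>] uminus_root assms by auto

text \<open>The quotient of the two Cartan numbers is the quotient of the square lengths, which
  exceeds 1. As their product is below 4, the smaller one is 1 in absolute value.\<close>

lemma cartan_longer:
  assumes "\<alpha> \<in> \<Phi>" "\<gamma> \<in> \<Phi>" "\<gamma> \<bullet> \<alpha> \<noteq> 0" "norm \<alpha> < norm \<gamma>"
  shows "\<bar>cartan \<gamma> \<alpha>\<bar> = (\<gamma> \<bullet> \<gamma>) / (\<alpha> \<bullet> \<alpha>)" "\<bar>cartan \<gamma> \<alpha>\<bar> \<in> {2, 3}"
proof -
  have nz: "\<alpha> \<noteq> 0" "\<gamma> \<noteq> 0" using root_nonzero assms by auto
  have lt: "cartan \<gamma> \<alpha> * cartan \<alpha> \<gamma> < 4"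
    using cartan_mult_less_4 assms by fastforce
  obtain i j where ij: "cartan \<gamma> \<alpha> = real_of_int i" "cartan \<alpha> \<gamma> = real_of_int j"
    using cartan_Ints assms by (meson Ints_cases)
  have r: "cartan \<gamma> \<alpha> = cartan \<alpha> \<gamma> * ((\<gamma> \<bullet> \<gamma>) / (\<alpha> \<bullet> \<alpha>))"
    using nz by (simp add: cartan_def inner_commute)
  have "(\<gamma> \<bullet> \<gamma>) / (\<alpha> \<bullet> \<alpha>) > 1"
    using nz assms(4)[unfolded norm_lt] by (simp add: less_divide_eq)
  moreover have jnz: "j \<noteq> 0"
    using cartan_eq_0_iff[OF nz(2), of \<alpha>] assms(3) ij by (simp add: inner_commute)
  ultimately have "\<bar>cartan \<alpha> \<gamma>\<bar> < \<bar>cartan \<gamma> \<alpha>\<bar>"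
    using ij unfolding r abs_mult by (intro mult_less_cancel_left1[THEN iffD2]) auto
  then have "\<bar>j\<bar> < \<bar>i\<bar>" using ij by linarith
  have "i * j < 4" using lt ij by (metis of_int_less_iff of_int_mult of_int_numeral)
  moreover have "i * j \<ge> 0"
  proof -
    have "cartan \<gamma> \<alpha> * cartan \<alpha> \<gamma> \<ge> 0"
      by (simp add: cartan_def inner_commute)
    then show ?thesis using ij by (metis of_int_0_le_iff of_int_mult)
  qed
  ultimately have p: "\<bar>i\<bar> * \<bar>j\<bar> < 4" by (simp flip: abs_mult)
  have "\<bar>j\<bar> = 1"
  proof (rule ccontr)
    assume "\<bar>j\<bar> \<noteq> 1"
    with jnz have "\<bar>j\<bar> \<ge> 2" by linarith
    with \<open>\<bar>j\<bar> < \<bar>i\<bar>\<close> have "2 * 2 \<le> \<bar>i\<bar> * \<bar>j\<bar>" by (intro mult_mono) auto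
    with p show False by simp
  qed
  then have "\<bar>cartan \<alpha> \<gamma>\<bar> = 1" using ij by linarith
  then show "\<bar>cartan \<gamma> \<alpha>\<bar> = (\<gamma> \<bullet> \<gamma>) / (\<alpha> \<bullet> \<alpha>)"
    unfolding r abs_mult by simp
  have "\<bar>i\<bar> = 2 \<or> \<bar>i\<bar> = 3" using p \<open>\<bar>j\<bar> = 1\<close> \<open>\<bar>j\<bar> < \<bar>i\<bar>\<close> by simp linarith
  then show "\<bar>cartan \<gamma> \<alpha>\<bar> \<in> {2, 3}" using ij by auto
qed

end

section \<open>Irreducible systems have at most two root lengths\<close>

locale irreducible_root_sys =
  fixes \<Phi> :: "'a::euclidean_space set"
  assumes irreducible: "irreducible_root_system \<Phi>"

sublocale irreducible_root_sys \<subseteq> root_sys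
  using irreducible by unfold_locales (simp add: irreducible_root_system_def)

context irreducible_root_sys
begin

text \<open>Makes the lengths of arbitrary roots comparable through a Cartan number. The roots that
  satisfy the claim form a set orthogonal to its complement, so by irreducibility the complement is
  empty.\<close>

lemma nonorthogonal_of_same_norm:
  assumes "\<alpha> \<in> \<Phi>" "\<gamma> \<in> \<Phi>"
  obtains \<delta> where "\<delta> \<in> \<Phi>" "norm \<delta> = norm \<alpha>" "\<delta> \<bullet> \<gamma> \<noteq> 0"
proof -
  define A where "A = {b \<in> \<Phi>. \<exists>x\<in>\<Phi>. norm x = norm \<alpha> \<and> x \<bullet> b \<noteq> 0}"
  have "a \<bullet> b = 0" if a: "a \<in> A" and b: "b \<in> \<Phi> - A" for a b
  proof -
    obtain x where x: "x \<in> \<Phi>" "norm x = norm \<alpha>" "x \<bullet> a \<noteq> 0" and aR: "a \<in> \<Phi>"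
      using a by (auto simp: A_def)
    have orth: "y \<bullet> b = 0" if "y \<in> \<Phi>" "norm y = norm \<alpha>" for y
      using that b by (auto simp: A_def)
    \<comment> \<open>Both \<open>x\<close> and its reflection are orthogonal to \<open>b\<close>,
      and they differ by a nonzero multiple of \<open>a\<close>.\<close>
    have "reflection a x \<bullet> b = 0"
      using orth reflection_root[OF aR x(1)] norm_reflection[OF root_nonzero[OF aR], of x] x(2) by simp
    with orth[OF x(1,2)] have "cartan x a * (a \<bullet> b) = 0"
      by (simp add: reflection_def inner_diff)
    then show ?thesis using cartan_eq_0_iff[OF root_nonzero[OF aR]] x(3) by simp
  qed
  moreover have "A \<noteq> {}"
    using assms(1) root_nonzero[OF assms(1)] by (auto simp: A_def intro!: exI[of _ \<alpha>])
  moreover have "A \<subseteq> \<Phi>" by (auto simp: A_def)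
  ultimately have "\<Phi> - A = {}"
    using irreducible unfolding irreducible_root_system_def
    by (metis Diff_disjoint Un_Diff_cancel Un_absorb1)
  with assms(2) have "\<gamma> \<in> A" by auto
  then show ?thesis using that by (auto simp: A_def)
qed

lemma norm_ratio:
  assumes "\<alpha> \<in> \<Phi>" "\<gamma> \<in> \<Phi>" "norm \<alpha> < norm \<gamma>"
  shows "2 * (\<alpha> \<bullet> \<alpha>) \<le> \<gamma> \<bullet> \<gamma>" "\<gamma> \<bullet> \<gamma> \<le> 3 * (\<alpha> \<bullet> \<alpha>)"
proof -
  obtain \<delta> where d: "\<delta> \<in> \<Phi>" "norm \<delta> = norm \<alpha>" "\<delta> \<bullet> \<gamma> \<noteq> 0"
    using nonorthogonal_of_same_norm assms by blast
  have "(\<gamma> \<bullet> \<gamma>) / (\<delta> \<bullet> \<delta>) \<in> {2, 3}"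
    using cartan_longer[of \<delta> \<gamma>] d assms by (simp add: inner_commute)
  moreover have "\<delta> \<bullet> \<delta> = \<alpha> \<bullet> \<alpha>" using d(2) by (simp add: norm_eq)
  moreover have "\<alpha> \<bullet> \<alpha> > 0" using root_nonzero assms by simp
  ultimately have "\<gamma> \<bullet> \<gamma> = 2 * (\<alpha> \<bullet> \<alpha>) \<or> \<gamma> \<bullet> \<gamma> = 3 * (\<alpha> \<bullet> \<alpha>)"
    by (auto simp: field_simps)
  with \<open>\<alpha> \<bullet> \<alpha> > 0\<close> show "2 * (\<alpha> \<bullet> \<alpha>) \<le> \<gamma> \<bullet> \<gamma>" "\<gamma> \<bullet> \<gamma> \<le> 3 * (\<alpha> \<bullet> \<alpha>)" by auto
qed

lemma short_root_iff:
  assumes "\<gamma> \<in> \<Phi>"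
  shows "short_root \<Phi> \<gamma> \<longleftrightarrow> \<not> long_root \<Phi> \<gamma>"
proof
  assume nl: "\<not> long_root \<Phi> \<gamma>"
  then obtain \<delta> where d: "\<delta> \<in> \<Phi>" "norm \<gamma> < norm \<delta>"
    using assms by (auto simp: long_root_def not_le)
  \<comment> \<open>With three lengths, two successive factors of at least 2 would give a square
    length ratio of at least 4, against the bound 3.\<close>
  have "norm \<gamma> \<le> norm \<epsilon>" if e: "\<epsilon> \<in> \<Phi>" for \<epsilon>
  proof (rule ccontr)
    assume "\<not> norm \<gamma> \<le> norm \<epsilon>"
    then have "norm \<epsilon> < norm \<gamma>" by simp
    moreover have "\<epsilon> \<bullet> \<epsilon> > 0" using root_nonzero e by simp
    ultimately show False
      using norm_ratio[of \<epsilon> \<gamma>] norm_ratio[of \<gamma> \<delta>] norm_ratio[of \<epsilon> \<delta>] d e assms by linarith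
  qed
  with nl assms show "short_root \<Phi> \<gamma>" by (simp add: short_root_def)
qed (simp add: short_root_def)

end

section \<open>Simple systems: coefficients, heights and the root order\<close>

locale based_root_sys = root_sys \<Phi> for \<Phi> :: "'a::euclidean_space set" +
  fixes \<Delta> :: "'a set"
  assumes simple: "simple_system \<Phi> \<Delta>"
begin

abbreviation coef :: "'a \<Rightarrow> 'a \<Rightarrow> real" where
  "coef \<equiv> representation \<Delta>"

definition height :: "'a \<Rightarrow> real" where
  "height x = (\<Sum>\<alpha>\<in>\<Delta>. coef x \<alpha>)"

lemma simple_root: "\<alpha> \<in> \<Delta> \<Longrightarrow> \<alpha> \<in> \<Phi>"
  using simple by (auto simp: simple_system_def)

lemma indep: "independent \<Delta>"
  using simple by (auto simp: simple_system_def)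

lemma finite_simple: "finite \<Delta>"
  using simple_root finite_roots by (meson finite_subset subsetI)

lemma in_span: "x \<in> span \<Delta>"
proof -
  have "span \<Phi> \<subseteq> span \<Delta>"
    using simple by (simp add: simple_system_def span_minimal)
  then show ?thesis using root_system by (auto simp: root_system_def)
qed

lemma coef_add: "coef (x + y) \<alpha> = coef x \<alpha> + coef y \<alpha>"
  using representation_add[OF indep in_span in_span] by simp

lemma coef_diff: "coef (x - y) \<alpha> = coef x \<alpha> - coef y \<alpha>"
  using representation_diff[OF indep in_span in_span] by simp

lemma coef_scale: "coef (r *\<^sub>R x) \<alpha> = r * coef x \<alpha>"
  using representation_scale[OF indep in_span] by simp

lemma coef_sum: "coef (sum v I) \<alpha> = (\<Sum>i\<in>I. coef (v i) \<alpha>)"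
  using fun_cong[OF representation_sum[OF indep in_span]] .

lemma coef_simple: "\<gamma> \<in> \<Delta> \<Longrightarrow> coef \<gamma> \<alpha> = (if \<alpha> = \<gamma> then 1 else 0)"
  using representation_basis[OF indep] by auto

lemma coef_expand: "(\<Sum>\<alpha>\<in>\<Delta>. coef x \<alpha> *\<^sub>R \<alpha>) = x"
  using sum_representation_eq[OF indep in_span finite_simple subset_refl] .

lemma coef_eqI:
  assumes "\<And>\<alpha>. \<alpha> \<in> \<Delta> \<Longrightarrow> coef x \<alpha> = coef y \<alpha>"
  shows "x = y"
proof -
  have "(\<Sum>\<alpha>\<in>\<Delta>. coef x \<alpha> *\<^sub>R \<alpha>) = (\<Sum>\<alpha>\<in>\<Delta>. coef y \<alpha> *\<^sub>R \<alpha>)"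
    by (intro sum.cong) (auto simp: assms)
  then show ?thesis by (simp only: coef_expand)
qed

lemma inner_expand: "x \<bullet> y = (\<Sum>\<alpha>\<in>\<Delta>. coef y \<alpha> * (x \<bullet> \<alpha>))"
  using arg_cong[OF coef_expand[of y], of "\<lambda>z. x \<bullet> z"] by (simp add: inner_sum_right)

lemma root_sign:
  "\<gamma> \<in> \<Phi> \<Longrightarrow> (\<forall>\<alpha>\<in>\<Delta>. coef \<gamma> \<alpha> \<ge> 0) \<or> (\<forall>\<alpha>\<in>\<Delta>. coef \<gamma> \<alpha> \<le> 0)"
  using simple by (auto simp: simple_system_def)

lemma coef_nonneg:
  assumes "\<gamma> \<in> \<Phi>" "a \<in> \<Delta>" "coef \<gamma> a > 0" "\<alpha> \<in> \<Delta>"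
  shows "coef \<gamma> \<alpha> \<ge> 0"
  using root_sign[OF assms(1)] assms by (meson not_le)

lemma height_diff: "height (x - y) = height x - height y"
  by (simp add: height_def coef_diff sum_subtractf)

lemma height_scale: "height (r *\<^sub>R x) = r * height x"
  by (simp add: height_def coef_scale sum_distrib_left)

lemma height_simple: "\<alpha> \<in> \<Delta> \<Longrightarrow> height \<alpha> = 1"
  by (simp add: height_def coef_simple finite_simple)

lemma height_reflection:
  assumes "\<alpha> \<in> \<Delta>"
  shows "height (reflection \<alpha> x) = height x - cartan x \<alpha>"
  using assms by (simp add: reflection_def height_diff height_scale height_simple)

lemma coef_reflection:
  assumes "\<alpha> \<in> \<Delta>" "a \<noteq> \<alpha>"
  shows "coef (reflection \<alpha> x) a = coef x a"
  using assms by (simp add: reflection_def coef_diff coef_scale coef_simple)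

lemma simple_inner_nonpos:
  assumes "\<alpha> \<in> \<Delta>" "\<gamma> \<in> \<Delta>" "\<alpha> \<noteq> \<gamma>"
  shows "\<alpha> \<bullet> \<gamma> \<le> 0"
proof (rule ccontr)
  assume "\<not> \<alpha> \<bullet> \<gamma> \<le> 0"
  then have "\<alpha> - \<gamma> \<in> \<Phi>" using diff_root assms simple_root by auto
  from root_sign[OF this] assms show False
    by (auto simp: coef_diff coef_simple)
qed

text \<open>Among the positive roots with the length of \<rho> and support inside that of \<rho>,
  one of least height must be simple: otherwise a simple reflection would lower it within this
  set.\<close>

lemma norm_eq_simple_in_support:
  assumes "\<rho> \<in> \<Phi>" "\<And>\<alpha>. \<alpha> \<in> \<Delta> \<Longrightarrow> coef \<rho> \<alpha> \<ge> 0"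
  obtains \<alpha> where "\<alpha> \<in> \<Delta>" "coef \<rho> \<alpha> \<noteq> 0" "norm \<alpha> = norm \<rho>"
proof -
  define T where "T = {x\<in>\<Phi>. norm x = norm \<rho> \<and> (\<forall>\<alpha>\<in>\<Delta>. coef x \<alpha> \<ge> 0) \<and>
    (\<forall>\<alpha>\<in>\<Delta>. coef \<rho> \<alpha> = 0 \<longrightarrow> coef x \<alpha> = 0)}"
  have "finite T" "T \<noteq> {}" using assms finite_roots by (auto simp: T_def)
  then obtain x where x: "x \<in> T" and min: "\<And>y. y \<in> T \<Longrightarrow> height x \<le> height y"
    using finite_minimizer[of _ height] by (metis (full_types))
  have xR: "x \<in> \<Phi>" using x by (simp add: T_def)
  have "x \<bullet> x > 0" using root_nonzero[OF xR] by simp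
  have "\<exists>\<alpha>\<in>\<Delta>. coef x \<alpha> * (x \<bullet> \<alpha>) > 0"
  proof (rule ccontr)
    assume "\<not> ?thesis"
    then have "(\<Sum>\<alpha>\<in>\<Delta>. coef x \<alpha> * (x \<bullet> \<alpha>)) \<le> 0"
      by (intro sum_nonpos) (auto simp: not_less)
    with \<open>x \<bullet> x > 0\<close> inner_expand[of x x] show False by simp
  qed
  then obtain \<alpha> where a: "\<alpha> \<in> \<Delta>" "coef x \<alpha> * (x \<bullet> \<alpha>) > 0" by blast
  moreover have "coef x \<alpha> \<ge> 0" using x a(1) by (simp add: T_def)
  ultimately have pos: "coef x \<alpha> > 0" "x \<bullet> \<alpha> > 0"
    by (auto simp: zero_less_mult_iff)
  have supp: "coef \<rho> \<alpha> \<noteq> 0" using x a pos by (auto simp: T_def)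
  show ?thesis
  proof (cases "\<exists>b\<in>\<Delta>. b \<noteq> \<alpha> \<and> coef x b \<noteq> 0")
    case False
    then have "x = coef x \<alpha> *\<^sub>R \<alpha>"
      using a(1) by (intro coef_eqI) (auto simp: coef_scale coef_simple)
    moreover from this have "coef x \<alpha> = 1"
      using root_multiple[OF simple_root[OF a(1)], of "coef x \<alpha>"] xR pos by auto
    ultimately have "x = \<alpha>" by simp
    with that[of \<alpha>] a supp x show ?thesis by (simp add: T_def)
  next
    case True
    then obtain b where b: "b \<in> \<Delta>" "b \<noteq> \<alpha>" "coef x b \<noteq> 0" by blast
    let ?y = "reflection \<alpha> x"
    have yR: "?y \<in> \<Phi>" using reflection_root simple_root a xR by blast
    \<comment> \<open>The reflection changes only the coefficient at \<alpha>. The positive one at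
      \<open>b\<close> survives and fixes the sign of all others.\<close>
    have "coef ?y b > 0" using x b a(1) by (simp add: T_def coef_reflection less_le)
    then have "\<forall>\<alpha>\<in>\<Delta>. coef ?y \<alpha> \<ge> 0" using coef_nonneg[OF yR b(1)] by blast
    moreover have "\<forall>d\<in>\<Delta>. coef \<rho> d = 0 \<longrightarrow> coef ?y d = 0"
    proof (intro ballI impI)
      fix d assume d: "d \<in> \<Delta>" "coef \<rho> d = 0"
      with supp have "d \<noteq> \<alpha>" by auto
      with d x show "coef ?y d = 0" using coef_reflection[OF a(1)] by (simp add: T_def)
    qed
    moreover have "norm ?y = norm \<rho>"
      using x norm_reflection[OF root_nonzero[OF simple_root[OF a(1)]]] by (simp add: T_def)
    ultimately have "?y \<in> T" using yR by (simp add: T_def)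
    from min[OF this] have "cartan x \<alpha> \<le> 0" using height_reflection[OF a(1)] by simp
    with pos(2) show ?thesis
      using cartan_pos_iff[OF root_nonzero[OF simple_root[OF a(1)]], of x] by simp
  qed
qed

text \<open>Together with \<open>root_leD\<close> this turns the root order into coefficientwise
  comparison. All weight can be put on the simple roots, which are themselves positive.\<close>

lemma root_leI:
  assumes "\<And>\<alpha>. \<alpha> \<in> \<Delta> \<Longrightarrow> coef x \<alpha> \<le> coef y \<alpha>"
  shows "root_le \<Phi> \<Delta> x y"
proof -
  have sub: "\<Delta> \<subseteq> positive_roots \<Phi> \<Delta>"
    using simple_root by (auto simp: positive_roots_def coef_simple)
  have fin: "finite (positive_roots \<Phi> \<Delta>)" using finite_roots by (simp add: positive_roots_def)
  let ?f = "\<lambda>\<epsilon>. if \<epsilon> \<in> \<Delta> then coef (y - x) \<epsilon> else 0"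
  have "(\<Sum>\<epsilon>\<in>positive_roots \<Phi> \<Delta>. ?f \<epsilon> *\<^sub>R \<epsilon>) = (\<Sum>\<epsilon>\<in>\<Delta>. coef (y - x) \<epsilon> *\<^sub>R \<epsilon>)"
    by (rule sum.mono_neutral_cong_right[OF fin sub]) auto
  then have "y - x = (\<Sum>\<epsilon>\<in>positive_roots \<Phi> \<Delta>. ?f \<epsilon> *\<^sub>R \<epsilon>)" by (simp only: coef_expand)
  moreover have "\<forall>\<epsilon>\<in>positive_roots \<Phi> \<Delta>. ?f \<epsilon> \<ge> 0" using assms by (simp add: coef_diff)
  ultimately show ?thesis unfolding root_le_def by (intro exI[of _ ?f] conjI)
qed

lemma root_leD:
  assumes "root_le \<Phi> \<Delta> x y" "\<alpha> \<in> \<Delta>"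
  shows "coef x \<alpha> \<le> coef y \<alpha>"
proof -
  obtain f where f: "\<forall>\<epsilon>\<in>positive_roots \<Phi> \<Delta>. f \<epsilon> \<ge> (0::real)"
    "y - x = (\<Sum>\<epsilon>\<in>positive_roots \<Phi> \<Delta>. f \<epsilon> *\<^sub>R \<epsilon>)"
    using assms(1) by (auto simp: root_le_def)
  have "coef (y - x) \<alpha> = (\<Sum>\<epsilon>\<in>positive_roots \<Phi> \<Delta>. coef (f \<epsilon> *\<^sub>R \<epsilon>) \<alpha>)"
    unfolding f(2) by (rule coef_sum)
  also have "\<dots> \<ge> 0"
    using f(1) assms(2) by (intro sum_nonneg) (simp add: coef_scale positive_roots_def)
  finally show ?thesis by (simp add: coef_diff)
qed

end

section \<open>The level set, its antidominant roots and its least element\<close>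

locale level_set = based_root_sys \<Phi> \<Delta> for \<Phi> \<Delta> :: "'a::euclidean_space set" +
  fixes S :: "'a set" and \<beta> :: 'a
  assumes S_sub: "S \<subseteq> \<Delta>"
    and pos_root: "\<beta> \<in> positive_roots \<Phi> \<Delta>"
    and S_meets: "S \<inter> Supp \<Delta> \<beta> \<noteq> {}"
begin

abbreviation L :: "'a set" where "L \<equiv> level_roots \<Phi> \<Delta> S \<beta>"

text \<open>Antidominance for the parabolic subgroup generated by the reflections in \<Delta> - S,
  the ones that preserve \<open>L\<close>.\<close>

definition antidominant :: "'a \<Rightarrow> bool" where
  "antidominant x \<longleftrightarrow> (\<forall>\<alpha>\<in>\<Delta> - S. x \<bullet> \<alpha> \<le> 0)"

text \<open>Every root of \<open>L\<close> has this same positive coefficient at \<open>a\<close>.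
  This separates \<open>L\<close> from 0 and from the span of \<Delta> - S.\<close>

lemma S_pivot: obtains a where "a \<in> S" "a \<in> \<Delta>" "coef \<beta> a > 0"
  using S_meets S_sub pos_root by (force simp: Supp_def positive_roots_def less_le)

lemma level_root: "x \<in> L \<Longrightarrow> x \<in> \<Phi>"
  by (simp add: level_roots_def)

lemma level_coef: "x \<in> L \<Longrightarrow> y \<in> L \<Longrightarrow> \<alpha> \<in> S \<Longrightarrow> coef x \<alpha> = coef y \<alpha>"
  by (simp add: level_roots_def)

lemma level_nonempty: "\<beta> \<in> L"
  using pos_root by (simp add: level_roots_def positive_roots_def)

lemma finite_level: "finite L"
  using finite_roots by (simp add: level_roots_def)

lemma level_not_minus_simple:
  assumes "x \<in> L" "\<alpha> \<in> \<Delta> - S"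
  shows "x \<noteq> - \<alpha>"
proof
  assume "x = - \<alpha>"
  then have "x = (-1) *\<^sub>R \<alpha>" by simp
  obtain a where a: "a \<in> S" "a \<in> \<Delta>" "coef \<beta> a > 0" by (rule S_pivot)
  then have "coef x a > 0" using level_coef[OF assms(1) level_nonempty] by simp
  moreover have "coef x a = 0"
    unfolding \<open>x = (-1) *\<^sub>R \<alpha>\<close> coef_scale using assms a(1) by (auto simp: coef_simple)
  ultimately show False by simp
qed

lemma reflection_level:
  assumes "x \<in> L" "\<alpha> \<in> \<Delta> - S"
  shows "reflection \<alpha> x \<in> L"
proof -
  have "coef (reflection \<alpha> x) a = coef \<beta> a" if "a \<in> S" for a
    using that assms coef_reflection[of \<alpha> a x] by (auto simp: level_roots_def)
  moreover have "reflection \<alpha> x \<in> \<Phi>"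
    using assms reflection_root simple_root level_root by blast
  ultimately show ?thesis by (simp add: level_roots_def)
qed

lemma norm_reflection_simple: "\<alpha> \<in> \<Delta> \<Longrightarrow> norm (reflection \<alpha> x) = norm x"
  using norm_reflection root_nonzero simple_root by blast

text \<open>Reflecting in \<alpha> lowers the height by the Cartan number. Minimality is demanded
  only against these reflections, so that the lemma serves for minimization over various subsets of
  \<open>L\<close>.\<close>

lemma antidominant_of_minimal_height:
  assumes "x \<in> L" "\<And>\<alpha>. \<alpha> \<in> \<Delta> - S \<Longrightarrow> x \<bullet> \<alpha> > 0 \<Longrightarrow> height x \<le> height (reflection \<alpha> x)"
  shows "antidominant x"
  unfolding antidominant_def
proof (intro ballI leI notI)
  fix \<alpha> assume a: "\<alpha> \<in> \<Delta> - S" and "x \<bullet> \<alpha> > 0"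
  moreover have "cartan x \<alpha> > 0"
    using cartan_pos_iff root_nonzero simple_root a \<open>x \<bullet> \<alpha> > 0\<close> by blast
  ultimately show False using assms(2)[of \<alpha>] height_reflection[of \<alpha> x] by simp
qed

lemma antidominant_conjugate:
  assumes "\<gamma> \<in> L"
  obtains x where "x \<in> L" "norm x = norm \<gamma>" "antidominant x"
proof -
  define T where "T = {x\<in>L. norm x = norm \<gamma>}"
  have "finite T" "T \<noteq> {}" using assms finite_level by (auto simp: T_def)
  then obtain x where x: "x \<in> T" and min: "\<And>y. y \<in> T \<Longrightarrow> height x \<le> height y"
    using finite_minimizer[of _ height] by (metis (full_types))
  have "reflection \<alpha> x \<in> T" if "\<alpha> \<in> \<Delta> - S" for \<alpha>
    using x that reflection_level[of x \<alpha>] norm_reflection_simple[of \<alpha> x] by (simp add: T_def)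
  then have "antidominant x"
    using antidominant_of_minimal_height[of x] min x by (auto simp: T_def)
  with that[of x] x show ?thesis by (simp add: T_def)
qed

text \<open>Split \<open>x - y\<close> into its positive and negative parts, so that \<open>x + u = y + v\<close> with \<open>u\<close>, \<open>v\<close>
  of disjoint support in \<open>\<Delta> - S\<close>; if \<open>x \<bullet> y \<le> 0\<close>, all terms of \<open>(x + u) \<bullet> (y + v)\<close> are nonpositive.\<close>

lemma antidominant_inner_pos:
  assumes "x \<in> L" "y \<in> L" "antidominant x" "antidominant y"
  shows "x \<bullet> y > 0"
proof (rule ccontr)
  assume "\<not> x \<bullet> y > 0"
  define p where "p = (\<lambda>\<alpha>. max 0 (coef y \<alpha> - coef x \<alpha>))"
  define q where "q = (\<lambda>\<alpha>. max 0 (coef x \<alpha> - coef y \<alpha>))"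
  define u where "u = (\<Sum>\<alpha>\<in>\<Delta>. p \<alpha> *\<^sub>R \<alpha>)"
  define v where "v = (\<Sum>\<alpha>\<in>\<Delta>. q \<alpha> *\<^sub>R \<alpha>)"
  have S0: "p \<alpha> = 0" "q \<alpha> = 0" if "\<alpha> \<in> S" for \<alpha>
    using level_coef[OF assms(1,2) that] by (simp_all add: p_def q_def)
  have eq: "x + u = y + v"
  proof -
    have "u - v = (\<Sum>\<alpha>\<in>\<Delta>. coef (y - x) \<alpha> *\<^sub>R \<alpha>)"
      unfolding u_def v_def sum_subtractf[symmetric]
      by (intro sum.cong) (auto simp: p_def q_def coef_diff scaleR_left_diff_distrib[symmetric])
    then have "u - v = y - x" by (simp only: coef_expand)
    then show ?thesis by (simp add: algebra_simps)
  qed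
  have "x \<bullet> v \<le> 0"
    unfolding v_def inner_sum_right using assms(3) S0
    by (intro sum_nonpos) (force simp: antidominant_def q_def mult_nonneg_nonpos)
  moreover have "u \<bullet> y \<le> 0"
    unfolding u_def inner_sum_left using assms(4) S0
    by (intro sum_nonpos) (force simp: antidominant_def p_def mult_nonneg_nonpos inner_commute)
  moreover have "u \<bullet> v \<le> 0"
    unfolding u_def v_def inner_sum_left inner_sum_right
  proof (intro sum_nonpos)
    fix a b assume ab: "a \<in> \<Delta>" "b \<in> \<Delta>"
    show "p a *\<^sub>R a \<bullet> q b *\<^sub>R b \<le> 0"
    proof (cases "a = b")
      case True
      then have "p a * q b = 0" by (simp add: p_def q_def max_def)
      then show ?thesis by auto
    next
      case False
      have "p a * (q b * (a \<bullet> b)) \<le> 0"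
        using simple_inner_nonpos[OF ab False]
        by (intro mult_nonneg_nonpos) (auto simp: p_def q_def)
      then show ?thesis by (simp add: algebra_simps)
    qed
  qed
  moreover have "(x + u) \<bullet> (x + u) = x \<bullet> y + x \<bullet> v + u \<bullet> y + u \<bullet> v"
    by (subst (2) eq) (simp add: inner_add)
  ultimately have "(x + u) \<bullet> (x + u) \<le> 0" using \<open>\<not> x \<bullet> y > 0\<close> by linarith
  then have "x + u = 0" by (metis inner_gt_zero_iff not_le)
  \<comment> \<open>As \<open>u\<close> involves only \<Delta> - S, the sum \<open>x + u\<close>
    keeps the positive coefficient of \<open>x\<close> at \<open>a\<close>, so it cannot
    vanish.\<close>
  moreover obtain a where a: "a \<in> S" "a \<in> \<Delta>" "coef \<beta> a > 0" by (rule S_pivot)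
  ultimately have "coef x a + coef u a = 0"
    using coef_add[of x u a] representation_zero[of \<Delta>] by simp
  moreover have "coef u a = (\<Sum>\<alpha>\<in>\<Delta>. coef (p \<alpha> *\<^sub>R \<alpha>) a)"
    unfolding u_def by (rule coef_sum)
  moreover have "\<dots> = 0"
    using S0(1)[OF a(1)] by (intro sum.neutral) (auto simp: coef_scale coef_simple)
  ultimately show False using a level_coef[OF assms(1) level_nonempty a(1)] by simp
qed

lemma antidominant_diff_root:
  assumes "x \<in> L" "y \<in> L" "antidominant x" "antidominant y" "x \<noteq> y"
  shows "x - y \<in> \<Phi>"
  using diff_root antidominant_inner_pos assms level_root by blast

text \<open>Take \<open>m\<close> of least height in \<open>L\<close>. Below any \<gamma> there is
  an antidominant \<open>x\<close> in \<open>L\<close>, and if \<open>x\<close> differs from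
  \<open>m\<close>, then \<open>x - m\<close> is a root, so its coefficients have one sign; least
  height of \<open>m\<close> decides which.\<close>

lemma ex_least_level:
  obtains m where "m \<in> L" "antidominant m" "\<And>\<gamma> \<alpha>. \<gamma> \<in> L \<Longrightarrow> \<alpha> \<in> \<Delta> \<Longrightarrow> coef m \<alpha> \<le> coef \<gamma> \<alpha>"
proof -
  have "L \<noteq> {}" using level_nonempty by blast
  with finite_level obtain m where m: "m \<in> L" and min: "\<And>y. y \<in> L \<Longrightarrow> height m \<le> height y"
    using finite_minimizer[of _ height] by (metis (full_types))
  have am: "antidominant m"
    using antidominant_of_minimal_height[OF m] min reflection_level[OF m] by blast
  have "coef m \<alpha> \<le> coef \<gamma> \<alpha>" if g: "\<gamma> \<in> L" and a: "\<alpha> \<in> \<Delta>" for \<gamma> \<alpha>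
  proof -
    define T where "T = {x\<in>L. \<forall>\<alpha>\<in>\<Delta>. coef x \<alpha> \<le> coef \<gamma> \<alpha>}"
    have "finite T" "T \<noteq> {}" using g finite_level by (auto simp: T_def)
    then obtain x where x: "x \<in> T" and minx: "\<And>y. y \<in> T \<Longrightarrow> height x \<le> height y"
      using finite_minimizer[of _ height] by (metis (full_types))
    have xL: "x \<in> L" and xle: "\<And>a. a \<in> \<Delta> \<Longrightarrow> coef x a \<le> coef \<gamma> a" using x by (auto simp: T_def)
    have ax: "antidominant x"
    proof (rule antidominant_of_minimal_height[OF xL])
      fix b assume b: "b \<in> \<Delta> - S" "x \<bullet> b > 0"
      then have "cartan x b > 0" using cartan_pos_iff root_nonzero simple_root by blast
      \<comment> \<open>Subtracting a positive multiple of \<open>b\<close> keeps the root below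
        \<gamma>.\<close>
      then have "coef (reflection b x) a \<le> coef \<gamma> a" if "a \<in> \<Delta>" for a
        using xle[OF that] b(1) \<open>cartan x b > 0\<close> by (auto simp: reflection_def coef_diff coef_scale coef_simple)
      then have "reflection b x \<in> T" using reflection_level[OF xL b(1)] by (simp add: T_def)
      then show "height x \<le> height (reflection b x)" by (rule minx)
    qed
    have "coef m \<alpha> \<le> coef x \<alpha>"
    proof (cases "x = m")
      case False
      then have "x - m \<in> \<Phi>" using antidominant_diff_root xL m ax am by blast
      from root_sign[OF this] show ?thesis
      proof
        assume "\<forall>\<alpha>\<in>\<Delta>. coef (x - m) \<alpha> \<le> 0"
        then have "\<forall>\<alpha>\<in>\<Delta>. coef (m - x) \<alpha> \<ge> 0" by (simp add: coef_diff)
        moreover have "(\<Sum>\<alpha>\<in>\<Delta>. coef (m - x) \<alpha>) \<le> 0"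
          using min[OF xL] height_diff[of m x] by (simp add: height_def)
        ultimately have "\<forall>\<alpha>\<in>\<Delta>. coef (m - x) \<alpha> = 0"
          using sum_nonneg_eq_0_iff[OF finite_simple] sum_nonneg
          by (metis (no_types, lifting) order_antisym)
        then show ?thesis using a by (simp add: coef_diff)
      qed (use a in \<open>simp add: coef_diff\<close>)
    qed simp
    with xle[OF a] show ?thesis by simp
  qed
  with that m am show ?thesis by blast
qed

definition m :: 'a where "m = min_level_root \<Phi> \<Delta> S \<beta>"

lemma m_level: "m \<in> L"
  and m_antidominant: "antidominant m"
  and m_least: "\<gamma> \<in> L \<Longrightarrow> \<alpha> \<in> \<Delta> \<Longrightarrow> coef m \<alpha> \<le> coef \<gamma> \<alpha>"
proof -
  obtain n where n: "n \<in> L" "antidominant n" "\<And>\<gamma> \<alpha>. \<gamma> \<in> L \<Longrightarrow> \<alpha> \<in> \<Delta> \<Longrightarrow> coef n \<alpha> \<le> coef \<gamma> \<alpha>"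
    using ex_least_level by blast
  have "m = n"
    unfolding m_def min_level_root_def
  proof (rule the_equality)
    show "n \<in> L \<and> (\<forall>\<gamma>\<in>L. root_le \<Phi> \<Delta> n \<gamma>)" using n root_leI by blast
    fix k assume k: "k \<in> L \<and> (\<forall>\<gamma>\<in>L. root_le \<Phi> \<Delta> k \<gamma>)"
    then show "k = n"
      using n root_leD by (intro coef_eqI order_antisym) blast+
  qed
  with n show "m \<in> L" "antidominant m" "\<gamma> \<in> L \<Longrightarrow> \<alpha> \<in> \<Delta> \<Longrightarrow> coef m \<alpha> \<le> coef \<gamma> \<alpha>" by auto
qed

text \<open>The difference is a nonnegative combination of \<Delta> - S, so its inner product with
  the antidominant \<gamma> is nonpositive. Expanding the square of
  \<open>m = \<gamma> - (\<gamma> - m)\<close> gives the inequality.\<close>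

lemma antidominant_diff_m:
  assumes "\<gamma> \<in> L" "antidominant \<gamma>" "\<gamma> \<noteq> m"
  shows "\<gamma> - m \<in> \<Phi>"
    and "\<gamma> \<bullet> \<gamma> + (\<gamma> - m) \<bullet> (\<gamma> - m) \<le> m \<bullet> m"
proof -
  let ?r = "\<gamma> - m"
  show "?r \<in> \<Phi>" using antidominant_diff_root assms m_level m_antidominant by blast
  have "coef ?r \<alpha> * (\<gamma> \<bullet> \<alpha>) \<le> 0" if "\<alpha> \<in> \<Delta>" for \<alpha>
  proof (cases "\<alpha> \<in> S")
    case True
    then show ?thesis using level_coef[OF assms(1) m_level] by (simp add: coef_diff)
  next
    case False
    then show ?thesis using assms(2) m_least[OF assms(1) that] that
      by (intro mult_nonneg_nonpos) (auto simp: coef_diff antidominant_def)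
  qed
  then have "\<gamma> \<bullet> ?r \<le> 0" unfolding inner_expand[of \<gamma> ?r] by (intro sum_nonpos)
  then show "\<gamma> \<bullet> \<gamma> + ?r \<bullet> ?r \<le> m \<bullet> m"
    by (simp add: inner_diff inner_commute)
qed

lemma norm_le_m:
  assumes "\<gamma> \<in> L"
  shows "norm \<gamma> \<le> norm m"
proof -
  obtain x where x: "x \<in> L" "norm x = norm \<gamma>" "antidominant x"
    using antidominant_conjugate assms by blast
  have "x \<bullet> x \<le> m \<bullet> m"
  proof (cases "x = m")
    case False
    from antidominant_diff_m(2)[OF x(1,3) this] inner_ge_zero[of "x - m"] show ?thesis by linarith
  qed simp
  with x(2) show ?thesis by (simp add: norm_eq_sqrt_inner)
qed

section \<open>The Dynkin component of the least root\<close>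

abbreviation component :: "'a set" where
  "component \<equiv> dynkin_component ((\<Delta> - S) \<union> {m}) m"

lemma component_step:
  assumes "x \<in> component" "y \<in> \<Delta> - S" "x \<bullet> y \<noteq> 0"
  shows "y \<in> component"
proof (cases "x = y")
  case False
  have "x \<in> (\<Delta> - S) \<union> {m}" using assms(1) by (simp add: dynkin_component_def)
  moreover from this have "x \<noteq> 0" "y \<noteq> 0"
    using assms(2) root_nonzero[OF level_root[OF m_level]] root_nonzero[OF simple_root] by auto
  ultimately have "(x, y) \<in> dynkin_edges ((\<Delta> - S) \<union> {m})"
    using assms False by (simp add: dynkin_edges_def cartan_eq_0_iff inner_commute)
  with assms show ?thesis by (auto simp: dynkin_component_def)
qed (use assms in simp)

text \<open>Let \<open>w\<close> be the part of \<gamma> - m supported outside the component. For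
  \<open>b\<close> in \<open>B\<close>, both \<open>m\<close> and the rest of \<gamma> - m are
  orthogonal to \<open>b\<close>, so \<open>w \<bullet> b = \<gamma> \<bullet> b \<le> 0\<close>.
  Hence \<open>w \<bullet> w \<le> 0\<close> and \<open>w\<close> vanishes.\<close>

lemma antidominant_support_component:
  assumes "\<gamma> \<in> L" "antidominant \<gamma>" "\<alpha> \<in> \<Delta>" "coef (\<gamma> - m) \<alpha> \<noteq> 0"
  shows "\<alpha> \<in> component"
proof -
  define B where "B = (\<Delta> - S) - component"
  define w where "w = (\<Sum>b\<in>B. coef (\<gamma> - m) b *\<^sub>R b)"
  have fB: "finite B" using finite_simple by (simp add: B_def)
  have mc: "m \<in> component" by (simp add: dynkin_component_def)
  have Borth: "x \<bullet> b = 0" if "x \<in> component" "b \<in> B" for x b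
    using component_step that by (auto simp: B_def)
  have nn: "coef (\<gamma> - m) b \<ge> 0" if "b \<in> \<Delta>" for b
    using m_least[OF assms(1) that] by (simp add: coef_diff)
  have S0: "coef (\<gamma> - m) b = 0" if "b \<in> S" for b
    using level_coef[OF assms(1) m_level that] by (simp add: coef_diff)
  have "w \<bullet> b \<le> 0" if b: "b \<in> B" for b
  proof -
    have "b \<bullet> (\<gamma> - m) = (\<Sum>a\<in>\<Delta>. coef (\<gamma> - m) a * (b \<bullet> a))" by (rule inner_expand)
    also have "\<dots> = (\<Sum>a\<in>B. coef (\<gamma> - m) a * (b \<bullet> a))"
      using Borth[OF _ b] S0 finite_simple
      by (intro sum.mono_neutral_right) (auto simp: B_def inner_commute)
    also have "\<dots> = b \<bullet> w" by (simp add: w_def inner_sum_right)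
    finally have "w \<bullet> b = \<gamma> \<bullet> b - m \<bullet> b" by (simp add: inner_commute inner_diff)
    moreover have "\<gamma> \<bullet> b \<le> 0" using assms(2) b by (auto simp: B_def antidominant_def)
    ultimately show ?thesis using Borth[OF mc b] by simp
  qed
  then have "(\<Sum>b\<in>B. coef (\<gamma> - m) b * (w \<bullet> b)) \<le> 0"
    using nn by (intro sum_nonpos mult_nonneg_nonpos) (auto simp: B_def)
  moreover have "w \<bullet> w = (\<Sum>b\<in>B. coef (\<gamma> - m) b * (w \<bullet> b))"
    by (subst (2) w_def) (simp add: inner_sum_right)
  ultimately have "w = 0" by (metis inner_gt_zero_iff not_le)
  have "coef (\<gamma> - m) b = 0" if "b \<in> B" for b
  proof -
    have "independent B" using independent_mono[OF indep, of B] by (auto simp: B_def)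
    then show ?thesis
      using independentD[OF _ fB subset_refl, of "coef (\<gamma> - m)" b] \<open>w = 0\<close> that by (simp add: w_def)
  qed
  with assms S0 show ?thesis by (auto simp: B_def)
qed

end

section \<open>Long and short roots in the level set\<close>

locale irreducible_level_set = irreducible_root_sys \<Phi> + level_set \<Phi> \<Delta> S \<beta>
  for \<Phi> \<Delta> S :: "'a::euclidean_space set" and \<beta> :: 'a
begin

lemma short_m_imp_all_short:
  assumes "short_root \<Phi> m" "\<gamma> \<in> L"
  shows "short_root \<Phi> \<gamma>"
proof -
  have "\<not> long_root \<Phi> \<gamma>"
    using assms norm_le_m[OF assms(2)] level_root[OF m_level]
    by (auto simp: short_root_def long_root_def intro: order_trans)
  then show ?thesis using short_root_iff level_root assms(2) by blast
qed

lemma long_component_imp_all_long: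
  assumes "\<And>\<alpha>. \<alpha> \<in> component \<Longrightarrow> long_root \<Phi> \<alpha>" "\<gamma> \<in> L"
  shows "long_root \<Phi> \<gamma>"
proof (rule ccontr)
  assume nl: "\<not> long_root \<Phi> \<gamma>"
  have lm: "long_root \<Phi> m" using assms(1) by (simp add: dynkin_component_def)
  obtain x where x: "x \<in> L" "norm x = norm \<gamma>" "antidominant x"
    using antidominant_conjugate assms(2) by blast
  have "x \<noteq> m" using x(1,2) lm nl level_root assms(2) by (auto simp: long_root_def)
  note r = antidominant_diff_m[OF x(1,3) this]
  have "coef (x - m) \<alpha> \<ge> 0" if "\<alpha> \<in> \<Delta>" for \<alpha>
    using m_least[OF x(1) that] by (simp add: coef_diff)
  then obtain \<alpha> where a: "\<alpha> \<in> \<Delta>" "coef (x - m) \<alpha> \<noteq> 0" "norm \<alpha> = norm (x - m)"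
    using norm_eq_simple_in_support[OF r(1)] by blast
  have "long_root \<Phi> \<alpha>" using assms(1) antidominant_support_component x a by blast
  \<comment> \<open>This contradicts \<open>r(2)\<close>, where the positive term
    \<open>x \<bullet> x\<close> makes \<open>x - m\<close> strictly shorter than
    \<open>m\<close>.\<close>
  then have "norm m \<le> norm (x - m)" using a(3) level_root[OF m_level] by (simp add: long_root_def)
  moreover have "x \<bullet> x > 0" using root_nonzero level_root x(1) by simp
  ultimately show False using r(2) norm_lt[of "x - m" m] by linarith
qed

text \<open>After a reflection the inner product is negative. For a longer root \<open>d\<close>,
  \<open>cartan_longer\<close> then gives
  \<open>2 * (d \<bullet> \<alpha>) = - (d \<bullet> d)\<close>, so \<open>d + \<alpha>\<close> has
  the length of \<alpha>.\<close>

lemma short_level_of_nonorthogonal: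
  assumes "\<delta> \<in> L" "long_root \<Phi> \<delta>" "\<alpha> \<in> \<Delta> - S" "\<not> long_root \<Phi> \<alpha>" "\<delta> \<bullet> \<alpha> \<noteq> 0"
  shows "\<exists>\<gamma>\<in>L. \<not> long_root \<Phi> \<gamma>"
proof -
  have aR: "\<alpha> \<in> \<Phi>" and anz: "\<alpha> \<noteq> 0" using assms(3) simple_root root_nonzero by auto
  have less: "norm \<alpha> < norm \<delta>"
    using assms(2,4) aR by (force simp: long_root_def not_le)
  define d where "d = (if \<delta> \<bullet> \<alpha> < 0 then \<delta> else reflection \<alpha> \<delta>)"
  have d: "d \<in> L" "norm d = norm \<delta>" "d \<bullet> \<alpha> < 0"
    using assms reflection_level norm_reflection[OF anz] reflection_inner_self[OF anz]
    by (auto simp: d_def)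
  have dR: "d \<in> \<Phi>" using d level_root by blast
  have "d + \<alpha> \<in> \<Phi>" using add_root[OF aR dR level_not_minus_simple[OF d(1) assms(3)] d(3)] .
  then have "d + \<alpha> \<in> L"
    using d(1) assms(3) by (auto simp: level_roots_def coef_add coef_simple)
  moreover have "\<not> long_root \<Phi> (d + \<alpha>)"
  proof -
    have "\<bar>cartan d \<alpha>\<bar> = (d \<bullet> d) / (\<alpha> \<bullet> \<alpha>)"
      using cartan_longer(1)[OF aR dR] d less by auto
    moreover have "cartan d \<alpha> < 0" using d(3) anz by (simp add: cartan_def divide_less_0_iff)
    ultimately have "2 * (d \<bullet> \<alpha>) = - (d \<bullet> d)" using anz by (simp add: cartan_def field_simps)
    then have "(d + \<alpha>) \<bullet> (d + \<alpha>) = \<alpha> \<bullet> \<alpha>" by (simp add: inner_add inner_commute)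
    then have "norm (d + \<alpha>) = norm \<alpha>" by (simp add: norm_eq_sqrt_inner)
    with assms(4) aR show ?thesis by (simp add: long_root_def)
  qed
  ultimately show ?thesis by blast
qed

text \<open>Otherwise every long root of \<open>L\<close> is orthogonal to all short roots of \<open>\<Delta> - S\<close>. Walking along the
  component, reflecting in its vertices gives for each vertex a long root of \<open>L\<close> that is not orthogonal to it.\<close>

lemma short_in_component_imp_short_level:
  assumes "long_root \<Phi> m" "\<alpha> \<in> component" "\<not> long_root \<Phi> \<alpha>"
  shows "\<exists>\<gamma>\<in>L. \<not> long_root \<Phi> \<gamma>"
proof (rule ccontr)
  assume contr: "\<not> ?thesis"
  have long: "long_root \<Phi> a" if "\<delta> \<in> L" "a \<in> \<Delta> - S" "\<delta> \<bullet> a \<noteq> 0" for \<delta> a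
    using contr short_level_of_nonorthogonal that by blast
  let ?P = "\<lambda>v. v = m \<or> (v \<in> \<Delta> - S \<and> (\<exists>\<delta>\<in>L. \<delta> \<bullet> v \<noteq> 0))"
  have "(m, \<alpha>) \<in> (dynkin_edges ((\<Delta> - S) \<union> {m}))\<^sup>*"
    using assms(2) by (simp add: dynkin_component_def)
  then have "?P \<alpha>"
  proof (induction rule: rtrancl_induct)
    case (step v w)
    have vw: "w \<in> (\<Delta> - S) \<union> {m}" "v \<bullet> w \<noteq> 0"
      using step(2) by (auto simp: dynkin_edges_def cartan_def)
    show ?case
    proof (cases "w = m \<or> v = m")
      case True
      \<comment> \<open>If \<open>v\<close> is \<open>m\<close>, then \<open>m\<close> itself is the
        required root of \<open>L\<close>.\<close>
      then show ?thesis using vw m_level by auto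
    next
      case False
      then have w: "w \<in> \<Delta> - S" using vw by blast
      from step.IH False obtain \<delta> where d: "v \<in> \<Delta> - S" "\<delta> \<in> L" "\<delta> \<bullet> v \<noteq> 0" by blast
      show ?thesis
      proof (cases "\<delta> \<bullet> w = 0")
        case True
        have "cartan \<delta> v \<noteq> 0" using d root_nonzero simple_root cartan_eq_0_iff by blast
        \<comment> \<open>As \<delta> is orthogonal to \<open>w\<close>, only the nonzero multiple
          of \<open>v\<close> contributes.\<close>
        with True vw(2) have "reflection v \<delta> \<bullet> w \<noteq> 0"
          by (simp add: reflection_def inner_diff)
        with reflection_level[OF d(2,1)] w show ?thesis by blast
      qed (use d w in blast)
    qed
  qed simp
  with long assms(1,3) show False by blast
qed

end

theorem proposition4p12:
  fixes \<Phi> \<Delta> S :: "'a::euclidean_space set" and \<beta> :: 'a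
  assumes "irreducible_root_system \<Phi>"
    and "simple_system \<Phi> \<Delta>"
    and "S \<subseteq> \<Delta>"
    and "\<beta> \<in> positive_roots \<Phi> \<Delta>"
    and "S \<inter> Supp \<Delta> \<beta> \<noteq> {}"
  shows "((\<forall>\<gamma>\<in>level_roots \<Phi> \<Delta> S \<beta>. short_root \<Phi> \<gamma>) \<longleftrightarrow>
            short_root \<Phi> (min_level_root \<Phi> \<Delta> S \<beta>))
       \<and> ((\<forall>\<gamma>\<in>level_roots \<Phi> \<Delta> S \<beta>. long_root \<Phi> \<gamma>) \<longleftrightarrow>
            long_root \<Phi> (min_level_root \<Phi> \<Delta> S \<beta>) \<and>
            (\<forall>\<alpha>\<in>dynkin_component ((\<Delta> - S) \<union> {min_level_root \<Phi> \<Delta> S \<beta>}) (min_level_root \<Phi> \<Delta> S \<beta>).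
               long_root \<Phi> \<alpha>))
       \<and> ((\<exists>\<gamma>\<in>level_roots \<Phi> \<Delta> S \<beta>. long_root \<Phi> \<gamma>) \<and> (\<exists>\<gamma>\<in>level_roots \<Phi> \<Delta> S \<beta>. short_root \<Phi> \<gamma>) \<longleftrightarrow>
            long_root \<Phi> (min_level_root \<Phi> \<Delta> S \<beta>) \<and>
            (\<exists>\<alpha>\<in>dynkin_component ((\<Delta> - S) \<union> {min_level_root \<Phi> \<Delta> S \<beta>}) (min_level_root \<Phi> \<Delta> S \<beta>).
               short_root \<Phi> \<alpha>))"
proof -
  interpret irreducible_level_set \<Phi> \<Delta> S \<beta>
    using assms by unfold_locales (auto simp: irreducible_root_system_def)
  have short: "short_root \<Phi> \<alpha> \<longleftrightarrow> \<not> long_root \<Phi> \<alpha>" if "\<alpha> \<in> component \<or> \<alpha> \<in> L" for \<alpha>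
    using that short_root_iff simple_root level_root m_level by (auto simp: dynkin_component_def)
  have 1: "short_root \<Phi> m \<Longrightarrow> \<forall>\<gamma>\<in>L. short_root \<Phi> \<gamma>"
    using short_m_imp_all_short by blast
  have 2: "\<forall>\<alpha>\<in>component. long_root \<Phi> \<alpha> \<Longrightarrow> \<forall>\<gamma>\<in>L. long_root \<Phi> \<gamma>"
    using long_component_imp_all_long by blast
  have 3: "long_root \<Phi> m \<Longrightarrow> \<exists>\<alpha>\<in>component. \<not> long_root \<Phi> \<alpha> \<Longrightarrow> \<exists>\<gamma>\<in>L. \<not> long_root \<Phi> \<gamma>"
    using short_in_component_imp_short_level by blast
  show ?thesis
    \<comment> \<open>The converse of \<open>1\<close> uses that \<open>m\<close> lies in
      \<open>L\<close>, that of \<open>2\<close> also uses \<open>3\<close>. If both lengths occur,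
      \<open>1\<close> makes \<open>m\<close> long and \<open>2\<close> gives a short root in the
      component.\<close>
    unfolding m_def[symmetric] using 1 2 3 short m_level by blast
qed

end
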